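(* Consider a stochastic generalized unsplittable flow problem on a network $G=(V,A)$ with $\bar V=\{q\}$, and let $\overline{\mathcal D}$ be a decision diagram constructed by the relaxed construction procedure (described in the context), with any choices of merged nodes, for the node $q$ and parameter $\Gamma$. Then $\overline{\mathcal D}$ represents a relaxation of the feasible region $\mathcal F$ of the master problem, where $\mathcal F$ is the set of all $(\boldsymbol w^q;z)$ with $\boldsymbol w^q=(w^q_1,\dots,w^q_{|\delta^-(q)|})$ satisfying $$\sum_{i\in\delta^-(q)}\operatorname{sign}\left(\left|w^q_{\operatorname{ind}^-(i,q)}-\operatorname{ind}^+(q,j)\right|\right)\ge|\delta^-(q)|-1\qquad\forall j\in\delta^+(q),$$ $$w^q_{\operatorname{ind}^-(i,q)}\in\{0,1,\dots,|\delta^+(q)|\}\qquad\forall i\in\delta^-(q),\qquad z\in[-\Gamma,\Gamma].$$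
   Context: Network. $G=(V,A)$ is a finite directed graph with $V=V'\cup\{s,t\}$ (source $s$, sink $t$), and $\bar V\subseteq V'$ is the set of nodes subject to the no-split no-merge requirement (each incoming arc is matched with at most one outgoing arc and vice versa). $\delta^-(q)=\{i:(i,q)\in A\}$, $\delta^+(q)=\{j:(q,j)\in A\}$. $\operatorname{ind}^-(i,q)$ is a one-to-one mapping from the incoming arcs $(i,q)$ onto $\{1,\dots,|\delta^-(q)|\}$ and $\operatorname{ind}^+(q,j)$ is a one-to-one mapping from the outgoing arcs $(q,j)$ onto $\{1,\dots,|\delta^+(q)|\}$. $\operatorname{sign}$ returns $1$, $0$, $-1$ for positive, zero, negative arguments. The master problem of the stochastic generalized unsplittable flow problem is $\max\{z:(\boldsymbol w;z)\in\mathcal F\}$, where $z$ stands for the (expected) second-stage objective value and $-\Gamma,\Gamma$ (with $\Gamma\ge0$) are given valid lower and upper bounds on $z$. Decision diagrams. A decision diagram $\mathcal D=(\mathcal U,\mathcal A,l)$ with $N$ arc layers is a directed acyclic (multi)graph with node layers $\mathcal U_1,\dots,\mathcal U_{N+1}$, where $\mathcal U_1=\{r\}$ (root) and $\mathcal U_{N+1}=\{t\}$ (terminal of the diagram), arc layers $\mathcal A_1,\dots,\mathcal A_N$, each arc of $\mathcal A_j$ going from a node of $\mathcal U_j$ to a node of $\mathcal U_{j+1}$ (parallel arcs allowed), and arc labels $l:\mathcal A\to\mathbb R$. An $r$-$t$ path $(a_1,\dots,a_N)$ encodes the point $(l(a_1),\dots,l(a_N))$. $\operatorname{Sol}(\mathcal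 D)$ is the finite collection of all $r$-$t$ paths, identified with the points they encode. Relaxed construction. Here $N=|\delta^-(q)|+1$; layer $h\le|\delta^-(q)|$ gives the value of $w^q_h$ and the last layer gives the value of $z$. Each node $u$ carries a state $s_u$. (1) Create the root $r\in\mathcal U_1$ with state $s_r=\{0,1,\dots,|\delta^+(q)|\}$. (2) For each $i=1,2,\dots,|\delta^-(q)|$ in turn and each $u\in\mathcal U_i$: (2a) for each $\ell\in s_u$, create a node $v\in\mathcal U_{i+1}$ with state $(s_u\setminus\{\ell\})\cup\{0\}$ and an arc in $\mathcal A_i$ from $u$ to $v$ with label $\ell$; (2b) select a subset of nodes $v_1,\dots,v_k$ of the current $\mathcal U_{i+1}$ and merge them into a single node $v'\in\mathcal U_{i+1}$ with state $s_{v'}=\bigcup_{j=1}^k s_{v_j}$, all arcs entering some $v_j$ being redirected, with their labels, to $v'$ (the selection is arbitrary; $k=1$ means no merging). (3) For each $u\in\mathcal U_{1+|\delta^-(q)|}$: create two arcs $a_1,a_2\in\mathcal A_{1+|\delta^-(q)|}$ from $u$ to the terminal node with labels $l(a_1)=\Gamma$ and $l(a_2)=-\Gamma$. Representation and relaxation. A finite set $S$ of points represents $\mathcal F$ (with respect to the continuous coordinate $z$) if $S$ is a subset of $\mathcal F$ that contains all extreme points of $\mathcal F$ (points of $\mathcal F$ that are extreme in its convex hull), and $\max\{f(\boldsymbol w,z):(\boldsymbol w,z)\in\mathcal F\}=\max\{f(\boldsymbol w,z):(\boldsymbol w,z)\in S\}$ for every real-valued function $f$ that is convex in $z$ (for each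 fixed $\boldsymbol w$). A decision diagram $\overline{\mathcal D}$ represents a relaxation of $\mathcal F$ if $\operatorname{Sol}(\overline{\mathcal D})\supseteq S$ for some finite set $S$ that represents $\mathcal F$. *)

theory Defs
  imports "HOL-Analysis.Analysis" "HOL-Analysis.Finite_Function_Topology"
    "Graph_Theory.Pair_Digraph" "Graph_Theory.Arc_Walk"
begin

section \<open>Networks and the feasible region of the master problem\<close>

definition in_nbrs :: "'v pair_pre_digraph \<Rightarrow> 'v \<Rightarrow> 'v set" where
  "in_nbrs G q = {i. (i, q) \<in> parcs G}"

definition out_nbrs :: "'v pair_pre_digraph \<Rightarrow> 'v \<Rightarrow> 'v set" where
  "out_nbrs G q = {j. (q, j) \<in> parcs G}"

text \<open>\<open>ind_in i q\<close> is the index of the incoming arc \<open>(i, q)\<close> and \<open>ind_out q j\<close> that of the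
  outgoing arc \<open>(q, j)\<close>. \<open>Vbar\<close> is the set of nodes with the no-split no-merge requirement.\<close>

locale unsplittable_network = pair_fin_digraph G
  for G :: "'v pair_pre_digraph" +
  fixes V' Vbar :: "'v set" and s t :: 'v
    and ind_in ind_out :: "'v \<Rightarrow> 'v \<Rightarrow> nat"
  assumes verts_eq: "pverts G = V' \<union> {s, t}"
    and Vbar_subset: "Vbar \<subseteq> V'"
    and ind_in_bij:
      "q \<in> Vbar \<Longrightarrow> bij_betw (\<lambda>i. ind_in i q) (in_nbrs G q) {1..card (in_nbrs G q)}"
    and ind_out_bij:
      "q \<in> Vbar \<Longrightarrow> bij_betw (\<lambda>j. ind_out q j) (out_nbrs G q) {1..card (out_nbrs G q)}"

text \<open>The dimension of the vector \<open>w\<close> is not known statically. A vector \<open>(w\<^sub>1, \<dots>, w\<^sub>n)\<close> is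
  represented by the finitely supported function with value \<open>w\<^sub>h\<close> at \<open>h \<in> {1..n}\<close> and \<open>0\<close>
  elsewhere; this embedding is linear, so convex hulls and extreme points are those of \<open>\<real>\<^sup>n \<times> \<real>\<close>.\<close>

type_synonym point = "(nat \<Rightarrow>\<^sub>0 real) \<times> real"

definition master_feasible ::
  "'v pair_pre_digraph \<Rightarrow> ('v \<Rightarrow> 'v \<Rightarrow> nat) \<Rightarrow> ('v \<Rightarrow> 'v \<Rightarrow> nat) \<Rightarrow> 'v \<Rightarrow> real \<Rightarrow> point set" where
  "master_feasible G ind_in ind_out q \<Gamma> =
    {(w, z).
      Poly_Mapping.keys w \<subseteq> {1..card (in_nbrs G q)} \<and>
      (\<forall>j\<in>out_nbrs G q.
        (\<Sum>i\<in>in_nbrs G q. sgn \<bar>Poly_Mapping.lookup w (ind_in i q) - real (ind_out q j)\<bar>)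
          \<ge> real (card (in_nbrs G q)) - 1) \<and>
      (\<forall>i\<in>in_nbrs G q. Poly_Mapping.lookup w (ind_in i q) \<in> real ` {0..card (out_nbrs G q)}) \<and>
      z \<in> {-\<Gamma>..\<Gamma>}}"


section \<open>Decision diagrams\<close>

text \<open>Arcs are abstract objects, so parallel arcs (even with equal labels) are possible. An arc
  layer consists of the arcs whose tails lie in the node layer with the same number.\<close>

record ('u, 'a) decision_diagram =
  dgraph :: "('u, 'a) pre_digraph"
  layer :: "'u \<Rightarrow> nat"
  label :: "'a \<Rightarrow> real"

definition node_layer :: "('u, 'a, 'z) decision_diagram_scheme \<Rightarrow> nat \<Rightarrow> 'u set" where
  "node_layer D j = {u \<in> verts (dgraph D). layer D u = j}"

definition is_decision_diagram :: "nat \<Rightarrow> ('u, 'a, 'z) decision_diagram_scheme \<Rightarrow> bool" where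
  "is_decision_diagram N D \<longleftrightarrow>
    fin_digraph (dgraph D) \<and>
    (\<forall>u\<in>verts (dgraph D). layer D u \<in> {1..N + 1}) \<and>
    (\<exists>r. node_layer D 1 = {r}) \<and>
    (\<exists>t. node_layer D (N + 1) = {t}) \<and>
    (\<forall>a\<in>arcs (dgraph D).
      layer D (head (dgraph D) a) = Suc (layer D (tail (dgraph D) a)))"

text \<open>The label sequence \<open>[l\<^sub>1, \<dots>, l\<^sub>N]\<close> of a path encodes the point \<open>w = (l\<^sub>1, \<dots>, l\<^bsub>N - 1\<^esub>)\<close>, \<open>z = l\<^sub>N\<close>.
  \<open>Poly_Mapping.nth\<close> counts from \<open>0\<close>, the coordinates of \<open>w\<close> from \<open>1\<close>.\<close>

definition point_of :: "real list \<Rightarrow> point" where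
  "point_of ls = (Poly_Mapping.nth (0 # butlast ls), last ls)"

definition Sol :: "nat \<Rightarrow> ('u, 'a, 'z) decision_diagram_scheme \<Rightarrow> point set" where
  "Sol N D = {point_of (map (label D) p) | p r t.
     r \<in> node_layer D 1 \<and> t \<in> node_layer D (N + 1) \<and> pre_digraph.awalk (dgraph D) r p t}"


section \<open>Representation and relaxation\<close>

definition is_max :: "('p \<Rightarrow> real) \<Rightarrow> 'p set \<Rightarrow> real \<Rightarrow> bool" where
  "is_max f X m \<longleftrightarrow> m \<in> f ` X \<and> (\<forall>x\<in>X. f x \<le> m)"

text \<open>Since \<open>S\<close> is finite, a nonempty \<open>S\<close> has a maximum for every \<open>f\<close>, and the last condition then
  says that the maximum over \<open>F\<close> is attained too, with the same value.\<close>

definition represents :: "point set \<Rightarrow> point set \<Rightarrow> bool" where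
  "represents S F \<longleftrightarrow>
    finite S \<and> S \<subseteq> F \<and>
    {x \<in> F. x extreme_point_of (convex hull F)} \<subseteq> S \<and>
    (\<forall>f. (\<forall>w. convex_on UNIV (\<lambda>z. f (w, z))) \<longrightarrow> (\<forall>m. is_max f F m \<longleftrightarrow> is_max f S m))"

definition represents_relaxation ::
  "nat \<Rightarrow> ('u, 'a, 'z) decision_diagram_scheme \<Rightarrow> point set \<Rightarrow> bool" where
  "represents_relaxation N D F \<longleftrightarrow>
    is_decision_diagram N D \<and> (\<exists>S. represents S F \<and> S \<subseteq> Sol N D)"


section \<open>The relaxed construction\<close>

record ('u, 'a) state_diagram = "('u, 'a) decision_diagram" +
  state :: "'u \<Rightarrow> nat set"

text \<open>Each step is a relation between the diagrams before and after it. Only the values of the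
  attributes on actual nodes and arcs matter; \<open>keeps C C'\<close> says that those of the nodes and arcs
  of \<open>C\<close> are unchanged in \<open>C'\<close>.\<close>

definition keeps :: "('u, 'a) state_diagram \<Rightarrow> ('u, 'a) state_diagram \<Rightarrow> bool" where
  "keeps C C' \<longleftrightarrow>
    (\<forall>u\<in>verts (dgraph C). layer C' u = layer C u \<and> state C' u = state C u) \<and>
    (\<forall>a\<in>arcs (dgraph C). tail (dgraph C') a = tail (dgraph C) a \<and>
      head (dgraph C') a = head (dgraph C) a \<and> label C' a = label C a)"

text \<open>For each \<open>l\<close> in the state of \<open>u\<close>, a new node \<open>nd l\<close> and a new arc \<open>ar l\<close> from \<open>u\<close> to it.\<close>

definition branch :: "'u \<Rightarrow> ('u, 'a) state_diagram \<Rightarrow> ('u, 'a) state_diagram \<Rightarrow> bool" where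
  "branch u C C' \<longleftrightarrow>
    (\<exists>nd ar.
      inj_on nd (state C u) \<and> nd ` state C u \<inter> verts (dgraph C) = {} \<and>
      inj_on ar (state C u) \<and> ar ` state C u \<inter> arcs (dgraph C) = {} \<and>
      verts (dgraph C') = verts (dgraph C) \<union> nd ` state C u \<and>
      arcs (dgraph C') = arcs (dgraph C) \<union> ar ` state C u \<and>
      keeps C C' \<and>
      (\<forall>l\<in>state C u.
        layer C' (nd l) = Suc (layer C u) \<and>
        state C' (nd l) = (state C u - {l}) \<union> {0} \<and>
        tail (dgraph C') (ar l) = u \<and>
        head (dgraph C') (ar l) = nd l \<and>
        label C' (ar l) = real l))"

text \<open>The merged node \<open>v'\<close> may be new or reuse the name of a node of \<open>K\<close>; in particular a singleton
  \<open>K\<close> allows the diagram to stay as it is.\<close>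

definition merge :: "nat \<Rightarrow> ('u, 'a) state_diagram \<Rightarrow> ('u, 'a) state_diagram \<Rightarrow> bool" where
  "merge i C C' \<longleftrightarrow>
    (\<exists>K v'.
      K \<noteq> {} \<and> K \<subseteq> node_layer C i \<and> v' \<notin> verts (dgraph C) - K \<and>
      verts (dgraph C') = (verts (dgraph C) - K) \<union> {v'} \<and>
      arcs (dgraph C') = arcs (dgraph C) \<and>
      layer C' v' = i \<and>
      state C' v' = (\<Union>v\<in>K. state C v) \<and>
      (\<forall>u\<in>verts (dgraph C) - K. layer C' u = layer C u \<and> state C' u = state C u) \<and>
      (\<forall>a\<in>arcs (dgraph C).
        tail (dgraph C') a = tail (dgraph C) a \<and>
        head (dgraph C') a = (if head (dgraph C) a \<in> K then v' else head (dgraph C) a) \<and>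
        label C' a = label C a))"

text \<open>\<open>process_nodes i W C C'\<close>: the nodes in \<open>W\<close>, the part of node layer \<open>i\<close> that is still to be
  processed, are treated one after the other, each by branching followed by a merge in the
  current node layer \<open>i + 1\<close>.\<close>

inductive process_nodes ::
  "nat \<Rightarrow> 'u set \<Rightarrow> ('u, 'a) state_diagram \<Rightarrow> ('u, 'a) state_diagram \<Rightarrow> bool" for i where
  finished: "process_nodes i {} C C"
| next_node: "u \<in> W \<Longrightarrow> branch u C C1 \<Longrightarrow> merge (Suc i) C1 C2 \<Longrightarrow>
    process_nodes i (W - {u}) C2 C3 \<Longrightarrow> process_nodes i W C C3"

text \<open>\<open>built m i C\<close>: \<open>C\<close> consists of the root and \<open>i\<close> further node layers.\<close>

inductive built :: "nat \<Rightarrow> nat \<Rightarrow> ('u, 'a) state_diagram \<Rightarrow> bool" for m where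
  root: "verts (dgraph C) = {r} \<Longrightarrow> arcs (dgraph C) = {} \<Longrightarrow> layer C r = 1 \<Longrightarrow>
    state C r = {0..m} \<Longrightarrow> built m 0 C"
| next_layer: "built m i C \<Longrightarrow> process_nodes (Suc i) (node_layer C (Suc i)) C C' \<Longrightarrow>
    built m (Suc i) C'"

definition add_terminal ::
  "nat \<Rightarrow> real \<Rightarrow> ('u, 'a) state_diagram \<Rightarrow> ('u, 'a) state_diagram \<Rightarrow> bool" where
  "add_terminal i \<Gamma> C C' \<longleftrightarrow>
    (\<exists>t a1 a2.
      t \<notin> verts (dgraph C) \<and>
      inj_on a1 (node_layer C i) \<and> inj_on a2 (node_layer C i) \<and>
      a1 ` node_layer C i \<inter> a2 ` node_layer C i = {} \<and>
      (a1 ` node_layer C i \<union> a2 ` node_layer C i) \<inter> arcs (dgraph C) = {} \<and>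
      verts (dgraph C') = verts (dgraph C) \<union> {t} \<and>
      arcs (dgraph C') = arcs (dgraph C) \<union> a1 ` node_layer C i \<union> a2 ` node_layer C i \<and>
      keeps C C' \<and>
      layer C' t = Suc i \<and>
      (\<forall>u\<in>node_layer C i.
        tail (dgraph C') (a1 u) = u \<and> head (dgraph C') (a1 u) = t \<and> label C' (a1 u) = \<Gamma> \<and>
        tail (dgraph C') (a2 u) = u \<and> head (dgraph C') (a2 u) = t \<and> label C' (a2 u) = -\<Gamma>))"

text \<open>\<open>n\<close> and \<open>m\<close> are the numbers of incoming and outgoing arcs of the node under consideration.\<close>

definition relaxed_construction :: "nat \<Rightarrow> nat \<Rightarrow> real \<Rightarrow> ('u, 'a) state_diagram \<Rightarrow> bool" where
  "relaxed_construction n m \<Gamma> D \<longleftrightarrow> (\<exists>C. built m n C \<and> add_terminal (Suc n) \<Gamma> C D)"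

end

theory Submission
  imports Defs
begin

text \<open>Let \<open>S\<close> consist of the feasible points with \<open>z = \<plusminus>\<Gamma>\<close>. It represents the feasible region because a
  convex function on \<open>[-\<Gamma>, \<Gamma>]\<close> is maximal at an end point. The feasible vectors \<open>w\<close> are those
  whose nonzero entries are distinct. Each step of the construction induces a morphism of diagrams
  that can only enlarge states, so the state of the end node of some path with labels \<open>w\<^sub>1, \<dots>, w\<^sub>i\<close>
  contains \<open>0\<close> and every index that is still unused; hence the path can be extended by any feasible
  value of \<open>w\<^bsub>i+1\<^esub>\<close>, whatever is merged.\<close>

section \<open>Layered diagrams and their morphisms\<close>

text \<open>This is \<open>is_decision_diagram\<close> without the terminal, hence an invariant of
  unfinished diagrams. The number \<open>k\<close> is only an upper bound on the layers, so the last
  layer may still be empty or incomplete.\<close>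

definition layered :: "nat \<Rightarrow> ('u, 'a, 'z) decision_diagram_scheme \<Rightarrow> bool" where
  "layered k D \<longleftrightarrow>
    fin_digraph (dgraph D) \<and>
    (\<forall>u\<in>verts (dgraph D). layer D u \<in> {1..k}) \<and>
    (\<exists>r. node_layer D 1 = {r}) \<and>
    (\<forall>a\<in>arcs (dgraph D).
      layer D (head (dgraph D) a) = Suc (layer D (tail (dgraph D) a)))"

text \<open>Branching creates one node and one arc per element of a state, so finite states keep the
  diagram finite.\<close>

definition finite_states :: "('u, 'a) state_diagram \<Rightarrow> bool" where
  "finite_states C \<longleftrightarrow> (\<forall>u\<in>verts (dgraph C). finite (state C u))"

lemma layered_iff:
  "layered k D \<longleftrightarrow>
    finite (verts (dgraph D)) \<and> finite (arcs (dgraph D)) \<and>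
    (\<forall>a\<in>arcs (dgraph D). tail (dgraph D) a \<in> verts (dgraph D) \<and>
      head (dgraph D) a \<in> verts (dgraph D) \<and>
      layer D (head (dgraph D) a) = Suc (layer D (tail (dgraph D) a))) \<and>
    (\<forall>u\<in>verts (dgraph D). 1 \<le> layer D u \<and> layer D u \<le> k) \<and>
    (\<exists>r. node_layer D 1 = {r})"
  unfolding layered_def fin_digraph_def fin_digraph_axioms_def wf_digraph_def by auto

lemma layered_mono: "layered k D \<Longrightarrow> k \<le> k' \<Longrightarrow> layered k' D"
  unfolding layered_def by fastforce

text \<open>Arcs keep their identity and only nodes are renamed: branching gives an inclusion,
  merging a collapse of nodes. States may grow because merging forms unions.\<close>

definition diagram_hom ::
  "('u \<Rightarrow> 'u) \<Rightarrow> ('u, 'a) state_diagram \<Rightarrow> ('u, 'a) state_diagram \<Rightarrow> bool" where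
  "diagram_hom f C C' \<longleftrightarrow>
    (\<forall>u\<in>verts (dgraph C). f u \<in> verts (dgraph C') \<and> layer C' (f u) = layer C u \<and>
      state C u \<subseteq> state C' (f u)) \<and>
    (\<forall>a\<in>arcs (dgraph C). a \<in> arcs (dgraph C') \<and>
      tail (dgraph C') a = f (tail (dgraph C) a) \<and>
      head (dgraph C') a = f (head (dgraph C) a) \<and>
      label C' a = label C a)"

lemma diagram_hom_id: "diagram_hom id C C"
  unfolding diagram_hom_def by simp

lemma diagram_hom_comp:
  "diagram_hom f C C' \<Longrightarrow> diagram_hom g C' C'' \<Longrightarrow> diagram_hom (g \<circ> f) C C''"
  unfolding diagram_hom_def by (auto; blast)

lemma keeps_imp_hom:
  assumes "keeps C C'" "verts (dgraph C) \<subseteq> verts (dgraph C')" "arcs (dgraph C) \<subseteq> arcs (dgraph C')"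
  shows "diagram_hom id C C'"
  using assms unfolding keeps_def diagram_hom_def by auto

text \<open>Paths grow at their end, in step with a construction that appends layers. Walks in the
  sense of \<open>awalk\<close> appear only for the finished diagram, through
  \<open>encodes_awalk\<close>.\<close>

inductive encodes :: "('u, 'a, 'z) decision_diagram_scheme \<Rightarrow> 'u \<Rightarrow> real list \<Rightarrow> bool"
  for D where
  root: "r \<in> node_layer D 1 \<Longrightarrow> encodes D r []"
| snoc: "encodes D (tail (dgraph D) a) ls \<Longrightarrow> a \<in> arcs (dgraph D) \<Longrightarrow>
    encodes D (head (dgraph D) a) (ls @ [label D a])"

lemma encodes_hom:
  assumes "encodes C u ls" "diagram_hom f C C'"
  shows "encodes C' (f u) ls"
  using assms(1)
proof induction
  case (root r)
  then show ?case
    using assms(2) by (intro encodes.root) (auto simp: diagram_hom_def node_layer_def)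
next
  case (snoc a ls)
  then show ?case
    using assms(2) encodes.snoc[of C' a ls] by (simp add: diagram_hom_def)
qed

lemma encodes_awalk:
  assumes "encodes D u ls" "wf_digraph (dgraph D)"
  shows "\<exists>r p. r \<in> node_layer D 1 \<and> pre_digraph.awalk (dgraph D) r p u \<and> map (label D) p = ls"
  using assms(1)
proof induction
  case (root r)
  then show ?case
    using wf_digraph.awalk_Nil_iff[OF assms(2)] by (force simp: node_layer_def)
next
  case (snoc a ls)
  then obtain r p where "r \<in> node_layer D 1"
    "pre_digraph.awalk (dgraph D) r p (tail (dgraph D) a)" "map (label D) p = ls"
    by blast
  moreover have "pre_digraph.awalk (dgraph D) (tail (dgraph D) a) [a] (head (dgraph D) a)"
    using wf_digraph.arc_implies_awalk[OF assms(2) snoc.hyps(2)]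
    by (simp add: arc_to_ends_def)
  ultimately have "pre_digraph.awalk (dgraph D) r (p @ [a]) (head (dgraph D) a)"
    "map (label D) (p @ [a]) = ls @ [label D a]"
    using wf_digraph.awalk_appendI[OF assms(2)] by auto
  with \<open>r \<in> node_layer D 1\<close> show ?case by blast
qed


section \<open>The steps of the construction\<close>

text \<open>The last claim asks only for an inclusion of states, the form that later merges
  preserve.\<close>

lemma branch_step:
  assumes "branch u C C'" "layered (Suc i) C" "finite_states C" "u \<in> node_layer C i"
  shows "layered (Suc i) C'" "finite_states C'" "diagram_hom id C C'"
    "\<And>l. l \<in> state C u \<Longrightarrow> \<exists>a\<in>arcs (dgraph C'). tail (dgraph C') a = u \<and> label C' a = real l \<and>
      (state C u - {l}) \<union> {0} \<subseteq> state C' (head (dgraph C') a)"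
proof -
  obtain nd ar where vs: "verts (dgraph C') = verts (dgraph C) \<union> nd ` state C u"
    and as: "arcs (dgraph C') = arcs (dgraph C) \<union> ar ` state C u"
    and k: "keeps C C'"
    and new: "\<forall>l\<in>state C u. layer C' (nd l) = Suc (layer C u) \<and>
        state C' (nd l) = (state C u - {l}) \<union> {0} \<and>
        tail (dgraph C') (ar l) = u \<and> head (dgraph C') (ar l) = nd l \<and> label C' (ar l) = real l"
    using assms(1) unfolding branch_def by metis
  have u: "u \<in> verts (dgraph C)" "layer C u = i"
    using assms(4) by (auto simp: node_layer_def)
  have fin: "finite (state C u)" using assms(3) u by (auto simp: finite_states_def)
  have L: "\<And>v. v \<in> verts (dgraph C) \<Longrightarrow> layer C' v = layer C v \<and> state C' v = state C v"
    using k by (auto simp: keeps_def)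
  \<comment> \<open>The new nodes lie in layer \<open>Suc i\<close>, which is at least 2, so the
    root stays alone in layer 1.\<close>
  have i: "1 \<le> i" using assms(2) u by (auto simp: layered_iff)
  have "node_layer C' 1 = node_layer C 1"
    using L new u i by (auto simp: node_layer_def vs)
  then show "layered (Suc i) C'"
    using assms(2) k new u fin i unfolding layered_iff
    by (auto simp: vs as keeps_def)
  show "finite_states C'"
    using assms(3) L new fin by (auto simp: finite_states_def vs)
  show "diagram_hom id C C'" using k by (rule keeps_imp_hom) (auto simp: vs as)
  show "\<exists>a\<in>arcs (dgraph C'). tail (dgraph C') a = u \<and> label C' a = real l \<and>
      (state C u - {l}) \<union> {0} \<subseteq> state C' (head (dgraph C') a)" if "l \<in> state C u" for l
    using that new by (intro bexI[of _ "ar l"]) (auto simp: as)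
qed

text \<open>The morphism sends \<open>K\<close> to \<open>v'\<close>. Since \<open>K\<close> lies in
  layer \<open>Suc i\<close>, it fixes the nodes of layer \<open>i\<close>, among them those still
  to be branched.\<close>

lemma merge_step:
  assumes "merge (Suc i) C C'" "layered (Suc i) C" "finite_states C" "1 \<le> i"
  shows "layered (Suc i) C'" "finite_states C'"
    "\<exists>f. diagram_hom f C C' \<and> (\<forall>u\<in>node_layer C i. f u = u)"
proof -
  obtain K v' where K: "K \<subseteq> node_layer C (Suc i)"
    and vs: "verts (dgraph C') = (verts (dgraph C) - K) \<union> {v'}"
    and as: "arcs (dgraph C') = arcs (dgraph C)"
    and v': "layer C' v' = Suc i" "state C' v' = (\<Union>v\<in>K. state C v)"
    and L: "\<forall>u\<in>verts (dgraph C) - K. layer C' u = layer C u \<and> state C' u = state C u"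
    and A: "\<forall>a\<in>arcs (dgraph C).
        tail (dgraph C') a = tail (dgraph C) a \<and>
        head (dgraph C') a = (if head (dgraph C) a \<in> K then v' else head (dgraph C) a) \<and>
        label C' a = label C a"
    using assms(1) unfolding merge_def by metis
  have lK: "\<And>v. v \<in> K \<Longrightarrow> v \<in> verts (dgraph C) \<and> layer C v = Suc i"
    using K by (auto simp: node_layer_def)
  \<comment> \<open>Nodes of \<open>K\<close> have no outgoing arcs yet: the head of such an arc
    would lie in layer \<open>i + 2\<close>, above the bound. Hence redirecting heads alone already
    gives a morphism.\<close>
  have tl: "tail (dgraph C) a \<notin> K" if "a \<in> arcs (dgraph C)" for a
  proof
    assume "tail (dgraph C) a \<in> K"
    then have "layer C (head (dgraph C) a) = Suc (Suc i)"
      using lK assms(2) that by (auto simp: layered_iff)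
    then show False using assms(2) that unfolding layered_iff
      by (metis Suc_n_not_le_n)
  qed
  have "u \<notin> K" if "layer C u = Suc 0" for u
    using lK that assms(4) by auto
  then have "node_layer C' 1 = node_layer C 1"
    using L v' assms(4) by (auto simp: node_layer_def vs)
  then show "layered (Suc i) C'"
    using assms(2) A L tl lK v' unfolding layered_iff
    by (auto simp: vs as)
  have "finite K" using K assms(2) finite_subset[of K "verts (dgraph C)"]
    by (auto simp: layered_iff node_layer_def)
  then show "finite_states C'"
    using assms(3) L lK v' by (auto simp: finite_states_def vs)
  show "\<exists>f. diagram_hom f C C' \<and> (\<forall>u\<in>node_layer C i. f u = u)"
  proof (intro exI conjI)
    show "diagram_hom (\<lambda>u. if u \<in> K then v' else u) C C'"
      using A L tl lK v' unfolding diagram_hom_def by (auto simp: vs as)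
    show "\<forall>u\<in>node_layer C i. (if u \<in> K then v' else u) = u"
      using lK by (auto simp: node_layer_def)
  qed
qed

text \<open>Each node of layer \<open>i\<close> keeps its name throughout, and the arcs made when it
  is processed are carried along by the later morphisms. The labels on offer refer to its state in
  the initial \<open>C\<close>, which is contained in its state at the time of processing.\<close>

lemma process_nodes_step:
  assumes "process_nodes i W C C'" "layered (Suc i) C" "finite_states C" "W \<subseteq> node_layer C i"
  shows "layered (Suc i) C' \<and> finite_states C' \<and>
    (\<exists>f. diagram_hom f C C' \<and> (\<forall>u\<in>node_layer C i. f u = u)) \<and>
    (\<forall>u\<in>W. \<forall>l\<in>state C u. \<exists>a\<in>arcs (dgraph C').
      tail (dgraph C') a = u \<and> label C' a = real l \<and>
      (state C u - {l}) \<union> {0} \<subseteq> state C' (head (dgraph C') a))"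
  using assms
proof induction
  case (finished C)
  then show ?case using diagram_hom_id by (auto intro!: exI[of _ id])
next
  case (next_node u W C C1 C2 C3)
  have u: "u \<in> node_layer C i" using next_node by blast
  then have i: "1 \<le> i" using next_node.prems(1) by (auto simp: layered_iff node_layer_def)
  note b = branch_step[OF next_node.hyps(2) next_node.prems(1,2) u]
  note m = merge_step[OF next_node.hyps(3) b(1,2) i]
  obtain f where f: "diagram_hom f C1 C2" "\<forall>u\<in>node_layer C1 i. f u = u"
    using m(3) by blast
  have nl1: "node_layer C i \<subseteq> node_layer C1 i"
    using b(3) by (auto simp: diagram_hom_def node_layer_def)
  have hom2: "diagram_hom f C C2" using diagram_hom_comp[OF b(3) f(1)] by simp
  have fid: "\<forall>u\<in>node_layer C i. f u = u" using f(2) nl1 by blast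
  have nl2: "node_layer C i \<subseteq> node_layer C2 i"
  proof
    fix v assume v: "v \<in> node_layer C i"
    then have "f v \<in> node_layer C2 i"
      using hom2 by (auto simp: diagram_hom_def node_layer_def)
    then show "v \<in> node_layer C2 i" using fid v by simp
  qed
  have IH: "layered (Suc i) C3" "finite_states C3"
    and "\<exists>g. diagram_hom g C2 C3 \<and> (\<forall>u\<in>node_layer C2 i. g u = u)"
    and IH4: "\<forall>u\<in>W - {u}. \<forall>l\<in>state C2 u. \<exists>a\<in>arcs (dgraph C3).
      tail (dgraph C3) a = u \<and> label C3 a = real l \<and>
      (state C2 u - {l}) \<union> {0} \<subseteq> state C3 (head (dgraph C3) a)"
    using next_node.IH[OF m(1,2)] next_node.prems(3) nl2 by blast+
  then obtain g where g: "diagram_hom g C2 C3" "\<forall>u\<in>node_layer C2 i. g u = u" by blast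
  have gfid: "\<forall>v\<in>node_layer C i. (g \<circ> f) v = v" using fid g(2) nl2 by auto
  \<comment> \<open>\<open>C1\<close> already holds the arcs just made for \<open>u\<close>; this
    composite carries them through the merge and all remaining nodes.\<close>
  have homgf1: "diagram_hom (g \<circ> f) C1 C3" using f(1) g(1) by (rule diagram_hom_comp)
  have "\<exists>a\<in>arcs (dgraph C3). tail (dgraph C3) a = v \<and> label C3 a = real l \<and>
      (state C v - {l}) \<union> {0} \<subseteq> state C3 (head (dgraph C3) a)"
    if v: "v \<in> W" and l: "l \<in> state C v" for v l
  proof (cases "v = u")
    case True
    then obtain a where a: "a \<in> arcs (dgraph C1)" "tail (dgraph C1) a = v" "label C1 a = real l"
      "(state C v - {l}) \<union> {0} \<subseteq> state C1 (head (dgraph C1) a)"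
      using b(4) l by blast
    have "head (dgraph C1) a \<in> verts (dgraph C1)" using b(1) a(1) by (auto simp: layered_iff)
    then have "state C1 (head (dgraph C1) a) \<subseteq> state C3 (head (dgraph C3) a)"
      using homgf1 a(1) unfolding diagram_hom_def by auto
    moreover have "a \<in> arcs (dgraph C3)" "tail (dgraph C3) a = (g \<circ> f) v" "label C3 a = real l"
      using homgf1 a unfolding diagram_hom_def by auto
    ultimately show ?thesis using a(4) gfid u True by (intro bexI[of _ a]) auto
  next
    case False
    \<comment> \<open>For a node processed later, the induction hypothesis speaks of its state in
      \<open>C2\<close>, which contains its state in \<open>C\<close>.\<close>
    have "v \<in> node_layer C i" using v next_node.prems(3) by blast
    then have sub: "state C v \<subseteq> state C2 v"
      using hom2 fid unfolding diagram_hom_def node_layer_def by fastforce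
    then obtain a where "a \<in> arcs (dgraph C3)" "tail (dgraph C3) a = v" "label C3 a = real l"
      "(state C2 v - {l}) \<union> {0} \<subseteq> state C3 (head (dgraph C3) a)"
      using IH4 v False l by blast
    then show ?thesis using sub by blast
  qed
  moreover have "diagram_hom (g \<circ> f) C C3" using hom2 g(1) by (rule diagram_hom_comp)
  ultimately show ?case using IH gfid by blast
qed


section \<open>Paths of the relaxed diagram\<close>

lemma built_layered:
  assumes "built m i C"
  shows "layered (Suc i) C \<and> finite_states C"
  using assms
proof induction
  case (root C r)
  then show ?case by (auto simp: layered_iff finite_states_def node_layer_def)
next
  case (next_layer i C C')
  then show ?case
    using process_nodes_step[OF next_layer.hyps(2)] layered_mono[of "Suc i" C "Suc (Suc i)"]
    by auto
qed

text \<open>Induction on the layers, splitting off the last label. Subtracting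
  \<open>set xs - {0}\<close> leaves 0 always available, matching the reinsertion of 0 at every
  branching.\<close>

lemma built_encodes:
  assumes "built m i C" "length xs = i" "set xs \<subseteq> {0..m}" "distinct (filter (\<lambda>x. x \<noteq> 0) xs)"
  shows "\<exists>u\<in>node_layer C (Suc i). encodes C u (map real xs) \<and> {0..m} - (set xs - {0}) \<subseteq> state C u"
  using assms
proof (induction arbitrary: xs)
  case (root C r)
  then have "r \<in> node_layer C 1" by (simp add: node_layer_def)
  then show ?case using root encodes.root[of r C] by (auto intro!: bexI[of _ r])
next
  case (next_layer i C C')
  obtain ys l where xs: "xs = ys @ [l]"
    using next_layer.prems(1) by (cases xs rule: rev_cases) auto
  obtain u where u: "u \<in> node_layer C (Suc i)" "encodes C u (map real ys)"
    "{0..m} - (set ys - {0}) \<subseteq> state C u"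
    using next_layer.IH[of ys] next_layer.prems by (auto simp: xs)
  \<comment> \<open>A nonzero \<open>l\<close> does not occur in \<open>ys\<close> by distinctness,
    and 0 is never removed.\<close>
  have l: "l \<in> state C u" using u(3) next_layer.prems by (auto simp: xs split: if_splits)
  note C = built_layered[OF next_layer.hyps(1)]
  note P = process_nodes_step[OF next_layer.hyps(2) _ _ order_refl]
  have P': "layered (Suc (Suc i)) C'"
    "\<exists>f. diagram_hom f C C' \<and> (\<forall>u\<in>node_layer C (Suc i). f u = u)"
    "\<exists>a\<in>arcs (dgraph C'). tail (dgraph C') a = u \<and> label C' a = real l \<and>
      (state C u - {l}) \<union> {0} \<subseteq> state C' (head (dgraph C') a)"
    using P C layered_mono[of "Suc i" C "Suc (Suc i)"] u(1) l by auto
  obtain f where f: "diagram_hom f C C'" "f u = u" using P'(2) u(1) by blast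
  obtain a where a: "a \<in> arcs (dgraph C')" "tail (dgraph C') a = u" "label C' a = real l"
    "(state C u - {l}) \<union> {0} \<subseteq> state C' (head (dgraph C') a)"
    using P'(3) by blast
  \<comment> \<open>The old path survives in \<open>C'\<close> and still ends in \<open>u\<close>,
    because \<open>f\<close> fixes \<open>u\<close>; so the new arc extends it.\<close>
  have eu: "encodes C' u (map real ys)" using encodes_hom[OF u(2) f(1)] f(2) by simp
  then have "encodes C' (head (dgraph C') a) (map real xs)"
    using encodes.snoc[of C' a "map real ys"] a by (simp add: xs)
  moreover have "layer C' u = Suc i"
    using f u(1) unfolding diagram_hom_def node_layer_def by fastforce
  then have "head (dgraph C') a \<in> node_layer C' (Suc (Suc i))"
    using P'(1) a(1,2) unfolding layered_iff node_layer_def by auto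
  moreover have "{0..m} - (set xs - {0}) \<subseteq> state C' (head (dgraph C') a)"
    using a(4) u(3) by (auto simp: xs)
  ultimately show ?case by blast
qed

section \<open>Adding the terminal layer\<close>

lemma relaxed_construction_decision_diagram:
  assumes "relaxed_construction n m \<Gamma> D"
  shows "is_decision_diagram (n + 1) D"
proof -
  obtain C where C: "built m n C" "add_terminal (Suc n) \<Gamma> C D"
    using assms unfolding relaxed_construction_def by blast
  let ?U = "node_layer C (Suc n)"
  obtain t a1 a2 where
    vs: "verts (dgraph D) = verts (dgraph C) \<union> {t}"
    and as: "arcs (dgraph D) = arcs (dgraph C) \<union> a1 ` ?U \<union> a2 ` ?U"
    and k: "keeps C D"
    and t: "layer D t = Suc (Suc n)"
    and new: "\<forall>u\<in>?U. tail (dgraph D) (a1 u) = u \<and> head (dgraph D) (a1 u) = t \<and>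
        tail (dgraph D) (a2 u) = u \<and> head (dgraph D) (a2 u) = t"
    using C(2) unfolding add_terminal_def by metis
  have L: "layered (Suc n) C" using built_layered[OF C(1)] by blast
  have ly: "\<And>v. v \<in> verts (dgraph C) \<Longrightarrow> layer D v = layer C v"
    using k by (auto simp: keeps_def)
  have fin: "finite ?U" using L by (auto simp: layered_iff node_layer_def)
  have "node_layer D 1 = node_layer C 1"
    using ly t by (auto simp: node_layer_def vs)
  moreover have U: "\<And>u. u \<in> ?U \<Longrightarrow> u \<in> verts (dgraph C) \<and> layer C u = Suc n"
    by (auto simp: node_layer_def)
  ultimately have "layered (Suc (Suc n)) D"
    using L k new t fin ly unfolding layered_iff keeps_def
    by (auto simp: vs as le_SucI)
  \<comment> \<open>All nodes of \<open>C\<close> lie in layers up to \<open>Suc n\<close>, which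
    leaves the terminal alone in the next one.\<close>
  moreover have "node_layer D (Suc (Suc n)) = {t}"
    using ly t L by (force simp: node_layer_def vs layered_iff)
  ultimately show ?thesis by (simp add: is_decision_diagram_def layered_def)
qed

lemma relaxed_construction_Sol:
  assumes D: "relaxed_construction n m \<Gamma> D"
    and xs: "length xs = n" "set xs \<subseteq> {0..m}" "distinct (filter (\<lambda>x. x \<noteq> 0) xs)"
    and z: "z \<in> {-\<Gamma>, \<Gamma>}"
  shows "point_of (map real xs @ [z]) \<in> Sol (n + 1) D"
proof -
  obtain C where C: "built m n C" "add_terminal (Suc n) \<Gamma> C D"
    using D unfolding relaxed_construction_def by blast
  let ?U = "node_layer C (Suc n)"
  obtain t a1 a2 where
    vs: "verts (dgraph D) = verts (dgraph C) \<union> {t}"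
    and as: "arcs (dgraph D) = arcs (dgraph C) \<union> a1 ` ?U \<union> a2 ` ?U"
    and k: "keeps C D"
    and t: "layer D t = Suc (Suc n)"
    and new: "\<forall>u\<in>?U.
        tail (dgraph D) (a1 u) = u \<and> head (dgraph D) (a1 u) = t \<and> label D (a1 u) = \<Gamma> \<and>
        tail (dgraph D) (a2 u) = u \<and> head (dgraph D) (a2 u) = t \<and> label D (a2 u) = -\<Gamma>"
    using C(2) unfolding add_terminal_def by metis
  have hom: "diagram_hom id C D" using k by (rule keeps_imp_hom) (auto simp: vs as)
  obtain u where u: "u \<in> ?U" "encodes C u (map real xs)"
    using built_encodes[OF C(1) xs] by blast
  \<comment> \<open>Both end values of z are on offer at \<open>u\<close>: \<open>a1 u\<close>
    carries \<Gamma> and \<open>a2 u\<close> carries -\<Gamma>.\<close>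
  obtain a where a: "a \<in> arcs (dgraph D)" "tail (dgraph D) a = u" "head (dgraph D) a = t"
    "label D a = z"
    using z new u(1) as by blast
  have "encodes D t (map real xs @ [z])"
    using encodes.snoc[of D a "map real xs"] encodes_hom[OF u(2) hom] a by simp
  moreover have "wf_digraph (dgraph D)"
    using relaxed_construction_decision_diagram[OF D]
    by (simp add: is_decision_diagram_def fin_digraph_def)
  ultimately have "\<exists>r p. r \<in> node_layer D 1 \<and> pre_digraph.awalk (dgraph D) r p t \<and>
      map (label D) p = map real xs @ [z]"
    by (rule encodes_awalk)
  then obtain r p where "r \<in> node_layer D 1" "pre_digraph.awalk (dgraph D) r p t"
    "map (label D) p = map real xs @ [z]"
    by blast
  moreover have "t \<in> node_layer D (n + 1 + 1)" using t by (simp add: node_layer_def vs)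
  ultimately show ?thesis unfolding Sol_def by (auto intro!: exI[of _ p])
qed


section \<open>The feasible region\<close>

text \<open>A term is 0 where \<open>g i = c\<close> and 1 elsewhere. Thus the constraint for
  \<open>j\<close> in the feasible region says that at most one coordinate has the value
  \<open>ind_out q j\<close>.\<close>

lemma sum_sgn_abs_diff:
  assumes "finite I"
  shows "(\<Sum>i\<in>I. sgn \<bar>g i - c\<bar>) = real (card I) - real (card {i \<in> I. g i = (c::real)})"
proof -
  have "(\<Sum>i\<in>I. sgn \<bar>g i - c\<bar>) = (\<Sum>i\<in>I. 1 - (if g i = c then 1 else 0))"
    by (intro sum.cong) (auto simp: sgn_if)
  also have "\<dots> = real (card I) - (\<Sum>i\<in>I. if g i = c then 1 else 0)"
    by (simp add: sum_subtractf)
  also have "(\<Sum>i\<in>I. if g i = c then 1 else 0) = real (card {i \<in> I. g i = c})"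
    using assms by (simp add: sum.If_cases Int_def)
  finally show ?thesis .
qed

text \<open>Since the incoming indexing is onto, conditions on neighbours become conditions on
  coordinates. Since the outgoing one is onto, every nonzero value has its own constraint, which
  excludes a second coordinate with that value.\<close>

lemma master_feasible_lists:
  assumes net: "unsplittable_network G V' {q} s t ind_in ind_out"
    and wz: "(w, z) \<in> master_feasible G ind_in ind_out q \<Gamma>"
  obtains xs where "length xs = card (in_nbrs G q)" "set xs \<subseteq> {0..card (out_nbrs G q)}"
    "distinct (filter (\<lambda>x. x \<noteq> 0) xs)" "(w, z) = point_of (map real xs @ [z])"
proof -
  interpret unsplittable_network G V' "{q}" s t ind_in ind_out by (rule net)
  let ?n = "card (in_nbrs G q)" and ?m = "card (out_nbrs G q)"
  let ?w = "Poly_Mapping.lookup w"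
  have "in_nbrs G q \<subseteq> fst ` parcs G" by (force simp: in_nbrs_def)
  then have fin: "finite (in_nbrs G q)"
    using finite_subset pair_finite_arcs by blast
  have bin: "(\<lambda>i. ind_in i q) ` in_nbrs G q = {1..?n}"
    using ind_in_bij[of q] by (simp add: bij_betw_def)
  have bout: "(\<lambda>j. ind_out q j) ` out_nbrs G q = {1..?m}"
    using ind_out_bij[of q] by (simp add: bij_betw_def)
  have keys: "Poly_Mapping.keys w \<subseteq> {1..?n}"
    and con: "\<And>j. j \<in> out_nbrs G q \<Longrightarrow>
        (\<Sum>i\<in>in_nbrs G q. sgn \<bar>?w (ind_in i q) - real (ind_out q j)\<bar>) \<ge> real ?n - 1"
    and dom: "\<And>i. i \<in> in_nbrs G q \<Longrightarrow> ?w (ind_in i q) \<in> real ` {0..?m}"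
    using wz by (auto simp: master_feasible_def)
  \<comment> \<open>The entries are natural numbers embedded in the reals; the floor recovers
    them.\<close>
  define v where "v h = nat \<lfloor>?w h\<rfloor>" for h
  have v: "?w h = real (v h) \<and> v h \<le> ?m" if "h \<in> {1..?n}" for h
  proof -
    have "h \<in> (\<lambda>i. ind_in i q) ` in_nbrs G q" using that by (simp add: bin)
    then obtain i where "i \<in> in_nbrs G q" "h = ind_in i q" by blast
    then obtain k where "k \<le> ?m" "?w h = real k" using dom[of i] by auto
    then show ?thesis by (simp add: v_def)
  qed
  have inj: "h = h'" if h: "h \<in> {1..?n}" "h' \<in> {1..?n}" and eq: "v h = v h'" "v h \<noteq> 0" for h h'
  proof -
    have "h \<in> (\<lambda>i. ind_in i q) ` in_nbrs G q" "h' \<in> (\<lambda>i. ind_in i q) ` in_nbrs G q"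
      using h by (simp_all add: bin)
    then obtain i i' where i: "i \<in> in_nbrs G q" "h = ind_in i q"
      "i' \<in> in_nbrs G q" "h' = ind_in i' q"
      by blast
    have "v h \<in> {1..?m}" using v[OF h(1)] eq(2) by auto
    then obtain j where j: "j \<in> out_nbrs G q" "v h = ind_out q j"
      using bout by (metis imageE)
    let ?I = "{i \<in> in_nbrs G q. ?w (ind_in i q) = real (ind_out q j)}"
    have "card ?I \<le> 1"
      using con[OF j(1)] unfolding sum_sgn_abs_diff[OF fin] by linarith
    moreover have "i \<in> ?I" "i' \<in> ?I" using v h i j eq by auto
    ultimately have "i = i'"
      using fin card_le_Suc0_iff_eq[of ?I] by auto
    then show ?thesis using i by simp
  qed
  let ?xs = "map v [1..<Suc ?n]"
  show thesis
  proof
    show "length ?xs = ?n" by simp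
    show "set ?xs \<subseteq> {0..?m}" using v by fastforce
    have "inj_on v {h \<in> {1..?n}. v h \<noteq> 0}" using inj by (auto simp: inj_on_def)
    then show "distinct (filter (\<lambda>x. x \<noteq> 0) ?xs)"
      unfolding filter_map distinct_map
      by (auto simp del: upt_Suc elim!: inj_on_subset)
    \<comment> \<open>The leading 0 fills coordinate 0: list positions start at 0, the entries of
      \<open>w\<close> at 1.\<close>
    have "w = Poly_Mapping.nth (0 # map real ?xs)"
    proof (rule poly_mapping_eqI)
      fix h
      show "?w h = Poly_Mapping.lookup (Poly_Mapping.nth (0 # map real ?xs)) h"
      proof (cases "h \<in> {1..?n}")
        case True
        then have "nth_default 0 (0 # map real ?xs) h = real (v h)"
          by (cases h) (auto simp: nth_default_def simp del: upt_Suc)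
        then show ?thesis using v[OF True] by (simp add: nth.rep_eq del: upt_Suc)
      next
        case False
        then have "nth_default 0 (0 # map real ?xs) h = 0"
          by (cases h) (auto simp: nth_default_def simp del: upt_Suc)
        moreover have "?w h = 0" using False keys by (auto simp: in_keys_iff)
        ultimately show ?thesis by (simp add: nth.rep_eq del: upt_Suc)
      qed
    qed
    then show "(w, z) = point_of (map real ?xs @ [z])" by (simp add: point_of_def del: upt_Suc)
  qed
qed

section \<open>Reduction to the end points of the z-interval\<close>

lemma convex_on_le_endpoint:
  fixes f :: "real \<Rightarrow> real"
  assumes "convex_on UNIV f" "z \<in> {a..b}"
  shows "f z \<le> f a \<or> f z \<le> f b"
proof -
  \<comment> \<open>The interval is the hull of its end points, and a bound of a convex function on
    the generators holds on the hull.\<close>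
  have "z \<in> convex hull {a, b}"
    using assms(2) by (auto simp: closed_segment_eq_real_ivl simp flip: segment_convex_hull)
  moreover have "convex_on (convex hull {a, b}) f" using assms(1) by (rule convex_on_subset) auto
  ultimately have "f z \<le> max (f a) (f b)"
    using convex_on_convex_hull_bound[of "{a, b}" f "max (f a) (f b)"] by auto
  then show ?thesis by (simp add: le_max_iff_disj)
qed

text \<open>The region is a product of a set of vectors with the interval. A point with z strictly
  inside is interior to a segment of its fibre, so it is not extreme, and convexity moves maxima to
  the ends of that fibre.\<close>

lemma endpoints_represent:
  fixes F :: "point set"
  assumes S: "S = {(w, z) \<in> F. z \<in> {-\<Gamma>, \<Gamma>}}" and "finite S"
    and bounds: "\<And>w z. (w, z) \<in> F \<Longrightarrow> z \<in> {-\<Gamma>..\<Gamma>}"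
    and fibres: "\<And>w z z'. (w, z) \<in> F \<Longrightarrow> z' \<in> {-\<Gamma>..\<Gamma>} \<Longrightarrow> (w, z') \<in> F"
  shows "represents S F"
  unfolding represents_def
proof (intro conjI allI impI)
  show "finite S" by fact
  show "S \<subseteq> F" by (auto simp: S)
  \<comment> \<open>Any point of the fibre witnesses \<open>-\<Gamma> \<le> \<Gamma>\<close>, so
    both end points lie in the interval.\<close>
  have ends: "(w, -\<Gamma>) \<in> S \<and> (w, \<Gamma>) \<in> S" if "(w, z) \<in> F" for w z
    using fibres[OF that] bounds[OF that] by (auto simp: S)
  show "{x \<in> F. x extreme_point_of convex hull F} \<subseteq> S"
  proof safe
    fix w z assume x: "(w, z) \<in> F" "(w, z) extreme_point_of convex hull F"
    show "(w, z) \<in> S"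
    proof (rule ccontr)
      assume "(w, z) \<notin> S"
      then have z: "-\<Gamma> < z" "z < \<Gamma>" using x(1) bounds[OF x(1)] by (auto simp: S)
      \<comment> \<open>The solution of \<open>(1 - c) * (-\<Gamma>) + c * \<Gamma> = z\<close>. The
        strict bounds on \<open>z\<close> force \<Gamma> to be positive, so the division is
        sound.\<close>
      define c where "c = (z + \<Gamma>) / (2 * \<Gamma>)"
      have c: "0 < c" "c < 1" using z by (auto simp: c_def field_simps)
      have "(1 - c) * (-\<Gamma>) + c * \<Gamma> = z" using z by (simp add: c_def field_simps)
      moreover have "(1 - c) *\<^sub>R w + c *\<^sub>R w = w" by (simp flip: scaleR_add_left)
      ultimately have "(w, z) = (1 - c) *\<^sub>R (w, -\<Gamma>) + c *\<^sub>R (w, \<Gamma>)" by simp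
      then have "(w, z) \<in> open_segment (w, -\<Gamma>) (w, \<Gamma>)"
        using c z unfolding in_segment by auto
      moreover have "(w, -\<Gamma>) \<in> convex hull F" "(w, \<Gamma>) \<in> convex hull F"
        using ends[OF x(1)] \<open>S \<subseteq> F\<close> by (auto intro: hull_inc)
      ultimately show False using x(2) unfolding extreme_point_of_def by blast
    qed
  qed
  fix f :: "point \<Rightarrow> real" and m
  assume "\<forall>w. convex_on UNIV (\<lambda>z. f (w, z))"
  then have dom: "\<exists>y\<in>S. f x \<le> f y" if "x \<in> F" for x
    using that convex_on_le_endpoint[of "\<lambda>z. f (fst x, z)" "snd x" "-\<Gamma>" \<Gamma>]
      ends[of "fst x" "snd x"] bounds[of "fst x" "snd x"] by auto
  show "is_max f F m \<longleftrightarrow> is_max f S m"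
  proof
    \<comment> \<open>The maximizer \<open>x\<close> is dominated by some \<open>y\<close> in
      \<open>S\<close>; maximality over \<open>F\<close> squeezes \<open>f y\<close> to
      \<open>m\<close>.\<close>
    assume F: "is_max f F m"
    then obtain x y where "x \<in> F" "m = f x" and y: "y \<in> S" "f x \<le> f y"
      using dom unfolding is_max_def by blast
    moreover from F y \<open>S \<subseteq> F\<close> have "f y \<le> m" unfolding is_max_def by blast
    ultimately have "m = f y" by simp
    with F y \<open>S \<subseteq> F\<close> show "is_max f S m" unfolding is_max_def by blast
  next
    assume "is_max f S m"
    with dom \<open>S \<subseteq> F\<close> show "is_max f F m" unfolding is_max_def by (blast intro: order_trans)
  qed
qed

theorem theorem2:
  fixes G :: "'v pair_pre_digraph" and V' Vbar :: "'v set" and s t q :: 'v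
    and ind_in ind_out :: "'v \<Rightarrow> 'v \<Rightarrow> nat" and \<Gamma> :: real
    and D :: "('u, 'a) state_diagram"
  assumes "unsplittable_network G V' Vbar s t ind_in ind_out"
    and "Vbar = {q}"
    and "\<Gamma> \<ge> 0"
    and "relaxed_construction (card (in_nbrs G q)) (card (out_nbrs G q)) \<Gamma> D"
  shows "represents_relaxation (card (in_nbrs G q) + 1) D (master_feasible G ind_in ind_out q \<Gamma>)"
proof -
  let ?n = "card (in_nbrs G q)" and ?m = "card (out_nbrs G q)"
  let ?F = "master_feasible G ind_in ind_out q \<Gamma>"
  define S where "S = {(w, z) \<in> ?F. z \<in> {-\<Gamma>, \<Gamma>}}"
  \<comment> \<open>Distinctness is dropped here: \<open>P\<close> serves only to show that
    \<open>S\<close> is finite.\<close>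
  define P where "P = {xs. set xs \<subseteq> {0..?m} \<and> length xs = ?n}"
  have net: "unsplittable_network G V' {q} s t ind_in ind_out" using assms(1,2) by simp
  have "S \<subseteq> (\<lambda>(xs, z). point_of (map real xs @ [z])) ` (P \<times> {-\<Gamma>, \<Gamma>})"
  proof safe
    fix w z assume "(w, z) \<in> S"
    then have wz: "(w, z) \<in> ?F" "z \<in> {-\<Gamma>, \<Gamma>}" by (auto simp: S_def)
    from master_feasible_lists[OF net wz(1)] obtain xs
      where "length xs = ?n" "set xs \<subseteq> {0..?m}" "(w, z) = point_of (map real xs @ [z])" .
    then show "(w, z) \<in> (\<lambda>(xs, z). point_of (map real xs @ [z])) ` (P \<times> {-\<Gamma>, \<Gamma>})"
      using wz(2) by (intro image_eqI[of _ _ "(xs, z)"]) (auto simp: P_def)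
  qed
  moreover have "finite P" unfolding P_def by (rule finite_lists_length_eq) simp
  ultimately have "finite S" using finite_subset by blast
  \<comment> \<open>The conditions on \<open>w\<close> do not involve z, so every nonempty fibre is
    the whole interval.\<close>
  with S_def have "represents S ?F"
    by (rule endpoints_represent) (auto simp: master_feasible_def)
  moreover have "S \<subseteq> Sol (?n + 1) D"
  proof safe
    fix w z assume "(w, z) \<in> S"
    then have wz: "(w, z) \<in> ?F" "z \<in> {-\<Gamma>, \<Gamma>}" by (auto simp: S_def)
    from master_feasible_lists[OF net wz(1)] show "(w, z) \<in> Sol (?n + 1) D"
      using relaxed_construction_Sol[OF assms(4) _ _ _ wz(2)] by metis
  qed
  ultimately show ?thesis
    using relaxed_construction_decision_diagram[OF assms(4)]
    unfolding represents_relaxation_def by blast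
qed

end
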